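(* Let $m,n$ be positive integers and let $\mathcal{A}^I=[\underline{\mathcal{A}},\overline{\mathcal{A}}]$ be an interval tensor in $T_{m,n}$. Then $\mathcal{A}^I$ is an interval B-tensor if and only if for each $i_1\in[n]$ both of the following hold: (a) $\sum_{i_2,\dots,i_m=1}^n \underline{a}_{i_1i_2\cdots i_m}>0$; (b) for all $(j_2,\dots,j_m)\neq(i_1,\dots,i_1)$, $$\sum_{(i_2,\dots,i_m)\neq(j_2,\dots,j_m)}\underline{a}_{i_1i_2\cdots i_m}>(n^{m-1}-1)\,\overline{a}_{i_1j_2\cdots j_m}.$$
   Context: $[n]=\{1,\dots,n\}$. $T_{m,n}$ is the set of real tensors $\mathcal{A}=(a_{i_1i_2\cdots i_m})$ with all indices in $[n]$. All index tuples $(i_2,\dots,i_m)$, $(j_2,\dots,j_m)$ range over $[n]^{m-1}$. For $\underline{\mathcal{A}}=(\underline{a}_{i_1\cdots i_m})\le\overline{\mathcal{A}}=(\overline{a}_{i_1\cdots i_m})$ in $T_{m,n}$ (entrywise), the interval tensor is $\mathcal{A}^I=[\underline{\mathcal{A}},\overline{\mathcal{A}}]=\{\mathcal{A}\in T_{m,n}:\underline{\mathcal{A}}\le\mathcal{A}\le\overline{\mathcal{A}}\}$. B-tensor: $\mathcal{A}\in T_{m,n}$ is a B-tensor if for all $i_1\in[n]$: $\sum_{i_2,\dots,i_m=1}^n a_{i_1i_2\cdots i_m}>0$, and $\frac{1}{n^{m-1}}\sum_{i_2,\dots,i_m=1}^n a_{i_1i_2\cdots i_m}>a_{i_1j_2\cdots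 j_m}$ for all $(j_2,\dots,j_m)\neq(i_1,\dots,i_1)$. $\mathcal{A}^I$ is an interval B-tensor if every $\mathcal{A}\in\mathcal{A}^I$ is a B-tensor. *)

theory Defs
  imports Complex_Main "HOL-Library.FuncSet"
begin

definition index_tuples :: "nat \<Rightarrow> nat \<Rightarrow> nat list set" where
  "index_tuples k n = {ks. length ks = k \<and> set ks \<subseteq> {1..n}}"

text \<open>
  The entry with indices \<open>i\<^sub>1, \<dots>, i\<^sub>m\<close> of a tensor \<open>A\<close> is \<open>A [i\<^sub>1, \<dots>, i\<^sub>m]\<close>, so
  \<open>A (i # ks)\<close> is the entry with first index \<open>i\<close> and remaining indices \<open>ks\<close>.
  Tensors are extensional functions, so that a tensor is determined by its entries.
\<close>

definition tensors :: "nat \<Rightarrow> nat \<Rightarrow> (nat list \<Rightarrow> real) set" where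
  "tensors m n = index_tuples m n \<rightarrow>\<^sub>E UNIV"

definition tensor_le :: "nat \<Rightarrow> nat \<Rightarrow> (nat list \<Rightarrow> real) \<Rightarrow> (nat list \<Rightarrow> real) \<Rightarrow> bool" where
  "tensor_le m n A B \<longleftrightarrow> (\<forall>ks\<in>index_tuples m n. A ks \<le> B ks)"

definition interval_tensor ::
    "nat \<Rightarrow> nat \<Rightarrow> (nat list \<Rightarrow> real) \<Rightarrow> (nat list \<Rightarrow> real) \<Rightarrow> (nat list \<Rightarrow> real) set" where
  "interval_tensor m n L U = {A \<in> tensors m n. tensor_le m n L A \<and> tensor_le m n A U}"

definition B_tensor :: "nat \<Rightarrow> nat \<Rightarrow> (nat list \<Rightarrow> real) \<Rightarrow> bool" where
  "B_tensor m n A \<longleftrightarrow> A \<in> tensors m n \<and>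
    (\<forall>i\<in>{1..n}.
      (\<Sum>ks\<in>index_tuples (m - 1) n. A (i # ks)) > 0 \<and>
      (\<forall>js\<in>index_tuples (m - 1) n. js \<noteq> replicate (m - 1) i \<longrightarrow>
        1 / real n ^ (m - 1) * (\<Sum>ks\<in>index_tuples (m - 1) n. A (i # ks)) > A (i # js)))"

definition interval_B_tensor :: "nat \<Rightarrow> nat \<Rightarrow> (nat list \<Rightarrow> real) set \<Rightarrow> bool" where
  "interval_B_tensor m n I \<longleftrightarrow> (\<forall>A\<in>I. B_tensor m n A)"

end

theory Submission
  imports Defs
begin

text \<open>
  Comparing an entry with the mean of its row is the same as comparing it with the other entries of
  the row: multiplying by the number \<open>N = n ^ (m - 1)\<close> of entries and cancelling the entry \<open>a\<close> itself
  turns \<open>mean > a\<close> into \<open>sum of the others > (N - 1) * a\<close> (lemma \<open>B_tensor_iff\<close>). In this form the entry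
  \<open>a\<close> occurs only on the right, with a nonnegative coefficient, and all other entries occur only on the
  left, with coefficient 1. Over an interval tensor the condition is therefore hardest to satisfy
  when \<open>a\<close> takes its upper bound and all other entries take their lower bounds. Such a tensor lies
  in the interval, so the conditions at these vertices are necessary; by monotonicity they imply
  the condition at every point. The positivity of the row sums is likewise decided by the lower
  bound tensor.
\<close>

lemma finite_index_tuples: "finite (index_tuples k n)"
  using finite_lists_length_eq[of "{1..n}" k]
  by (simp add: index_tuples_def conj_commute)

lemma card_index_tuples: "card (index_tuples k n) = n ^ k"
  using card_lists_length_eq[of "{1..n}" k]
  by (simp add: index_tuples_def conj_commute)

lemma Cons_mem_index_tuples:
  assumes "m \<ge> 1" "i \<in> {1..n}" "ks \<in> index_tuples (m - 1) n"
  shows "i # ks \<in> index_tuples m n"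
  using assms by (auto simp: index_tuples_def)

lemma less_mean_iff_less_sum_others:
  fixes f :: "'a \<Rightarrow> real"
  assumes "finite K" "j \<in> K"
  shows "f j < 1 / real (card K) * sum f K \<longleftrightarrow> (real (card K) - 1) * f j < sum f (K - {j})"
proof -
  have "card K > 0"
    using assms by (auto simp: card_gt_0_iff)
  moreover have "sum f K = f j + sum f (K - {j})"
    using assms by (rule sum.remove)
  ultimately show ?thesis
    by (simp add: field_simps)
qed

lemma B_tensor_iff:
  assumes "A \<in> tensors m n"
  shows "B_tensor m n A \<longleftrightarrow>
    (\<forall>i\<in>{1..n}.
      (\<Sum>ks\<in>index_tuples (m - 1) n. A (i # ks)) > 0 \<and>
      (\<forall>js\<in>index_tuples (m - 1) n. js \<noteq> replicate (m - 1) i \<longrightarrow>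
        (\<Sum>ks\<in>index_tuples (m - 1) n - {js}. A (i # ks)) > (real n ^ (m - 1) - 1) * A (i # js)))"
  using assms less_mean_iff_less_sum_others[OF finite_index_tuples, of _ "m - 1" n "\<lambda>ks. A (_ # ks)"]
  by (simp add: B_tensor_def card_index_tuples)

lemma lower_mem_interval_tensor:
  assumes "L \<in> tensors m n" "tensor_le m n L U"
  shows "L \<in> interval_tensor m n L U"
  using assms by (simp add: interval_tensor_def tensor_le_def)

lemma lower_with_upper_entry_mem_interval_tensor:
  assumes "L \<in> tensors m n" "tensor_le m n L U" "xs \<in> index_tuples m n"
  shows "L(xs := U xs) \<in> interval_tensor m n L U"
  using assms by (auto simp: interval_tensor_def tensor_le_def tensors_def PiE_iff extensional_def)

theorem theorem3p1:
  fixes m n :: nat and L U :: "nat list \<Rightarrow> real"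
  assumes "m \<ge> 1" and "n \<ge> 1"
    and "L \<in> tensors m n" and "U \<in> tensors m n" and "tensor_le m n L U"
  shows "interval_B_tensor m n (interval_tensor m n L U) \<longleftrightarrow>
    (\<forall>i\<in>{1..n}.
      (\<Sum>ks\<in>index_tuples (m - 1) n. L (i # ks)) > 0 \<and>
      (\<forall>js\<in>index_tuples (m - 1) n. js \<noteq> replicate (m - 1) i \<longrightarrow>
        (\<Sum>ks\<in>index_tuples (m - 1) n - {js}. L (i # ks)) > (real n ^ (m - 1) - 1) * U (i # js)))"
proof
  assume B: "interval_B_tensor m n (interval_tensor m n L U)"
  show "\<forall>i\<in>{1..n}.
      (\<Sum>ks\<in>index_tuples (m - 1) n. L (i # ks)) > 0 \<and>
      (\<forall>js\<in>index_tuples (m - 1) n. js \<noteq> replicate (m - 1) i \<longrightarrow>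
        (\<Sum>ks\<in>index_tuples (m - 1) n - {js}. L (i # ks)) > (real n ^ (m - 1) - 1) * U (i # js))"
  proof (intro ballI conjI impI)
    fix i assume i: "i \<in> {1..n}"
    have "B_tensor m n L"
      using B lower_mem_interval_tensor[OF assms(3,5)] by (simp add: interval_B_tensor_def)
    then show "(\<Sum>ks\<in>index_tuples (m - 1) n. L (i # ks)) > 0"
      using i by (simp add: B_tensor_def)
  next
    fix i js
    assume i: "i \<in> {1..n}" and js: "js \<in> index_tuples (m - 1) n" "js \<noteq> replicate (m - 1) i"
    \<comment> \<open>The vertex of the interval at which the inequality for the entry \<open>i # js\<close> is tightest.\<close>
    define V where "V = L(i # js := U (i # js))"
    have V_mem: "V \<in> interval_tensor m n L U"
      unfolding V_def using assms(3,5) Cons_mem_index_tuples[OF assms(1) i js(1)]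
      by (rule lower_with_upper_entry_mem_interval_tensor)
    then have "B_tensor m n V" "V \<in> tensors m n"
      using B by (auto simp: interval_B_tensor_def interval_tensor_def)
    then have "(\<Sum>ks\<in>index_tuples (m - 1) n - {js}. V (i # ks)) > (real n ^ (m - 1) - 1) * V (i # js)"
      using i js by (simp add: B_tensor_iff)
    moreover have "(\<Sum>ks\<in>index_tuples (m - 1) n - {js}. V (i # ks))
        = (\<Sum>ks\<in>index_tuples (m - 1) n - {js}. L (i # ks))"
      by (rule sum.cong) (auto simp: V_def)
    ultimately show "(\<Sum>ks\<in>index_tuples (m - 1) n - {js}. L (i # ks))
        > (real n ^ (m - 1) - 1) * U (i # js)"
      by (simp add: V_def)
  qed
next
  assume R: "\<forall>i\<in>{1..n}.
      (\<Sum>ks\<in>index_tuples (m - 1) n. L (i # ks)) > 0 \<and>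
      (\<forall>js\<in>index_tuples (m - 1) n. js \<noteq> replicate (m - 1) i \<longrightarrow>
        (\<Sum>ks\<in>index_tuples (m - 1) n - {js}. L (i # ks)) > (real n ^ (m - 1) - 1) * U (i # js))"
  show "interval_B_tensor m n (interval_tensor m n L U)"
    unfolding interval_B_tensor_def
  proof
    fix A assume "A \<in> interval_tensor m n L U"
    then have A: "A \<in> tensors m n" and LA: "tensor_le m n L A" and AU: "tensor_le m n A U"
      by (auto simp: interval_tensor_def)
    have sum_le: "(\<Sum>ks\<in>K. L (i # ks)) \<le> (\<Sum>ks\<in>K. A (i # ks))"
      if "i \<in> {1..n}" "K \<subseteq> index_tuples (m - 1) n" for i K
      using LA that Cons_mem_index_tuples[OF assms(1) that(1)]
      by (intro sum_mono) (auto simp: tensor_le_def)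
    show "B_tensor m n A"
      unfolding B_tensor_iff[OF A]
    proof (intro ballI conjI impI)
      fix i assume i: "i \<in> {1..n}"
      show "(\<Sum>ks\<in>index_tuples (m - 1) n. A (i # ks)) > 0"
        using R i sum_le[OF i order_refl] by fastforce
    next
      fix i js
      assume i: "i \<in> {1..n}" and js: "js \<in> index_tuples (m - 1) n" "js \<noteq> replicate (m - 1) i"
      have "A (i # js) \<le> U (i # js)"
        using AU Cons_mem_index_tuples[OF assms(1) i js(1)] by (simp add: tensor_le_def)
      moreover have "real n ^ (m - 1) - 1 \<ge> 0"
        using assms(2) by simp
      ultimately have "(real n ^ (m - 1) - 1) * A (i # js) \<le> (real n ^ (m - 1) - 1) * U (i # js)"
        by (rule mult_left_mono)
      also have "\<dots> < (\<Sum>ks\<in>index_tuples (m - 1) n - {js}. L (i # ks))"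
        using R i js by blast
      also have "\<dots> \<le> (\<Sum>ks\<in>index_tuples (m - 1) n - {js}. A (i # ks))"
        using i by (rule sum_le) blast
      finally show "(\<Sum>ks\<in>index_tuples (m - 1) n - {js}. A (i # ks))
          > (real n ^ (m - 1) - 1) * A (i # js)" .
    qed
  qed
qed

end
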